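(* There exists a $(65536,21845,7224,7310)$ negative Latin-square-type partial difference set in $\mathbb{Z}_4^4\times\mathbb{Z}_{16}^2$.
   Context: All groups are finite and written additively, and $\mathbb{Z}_m=\mathbb{Z}/m\mathbb{Z}$. A subset $D$ of size $k$ of a finite group $G$ of order $v$ is a $(v,k,\lambda,\mu)$ partial difference set (PDS) if the multiset of differences $\{d_1-d_2 : d_1,d_2\in D,\ d_1\neq d_2\}$ contains each non-identity element of $D$ exactly $\lambda$ times and each non-identity element of $G$ not in $D$ exactly $\mu$ times. A PDS has negative Latin-square-type parameters (is of negative Latin-square type) if its parameters have the form $(v,k,\lambda,\mu)=(n^2,\ r(n+1),\ -n+r^2+3r,\ r^2+r)$ for some positive integers $n,r$. *)

theory Defs
  imports
    "HOL-Analysis.Finite_Cartesian_Product"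
    "HOL-Library.Numeral_Type"
    "HOL-Library.Product_Plus"
    "HOL-Library.Multiset"
begin

text \<open>
  The ambient group is a finite type of class \<^class>\<open>group_add\<close>. The cyclic group of
  order 4 is the numeral type \<^typ>\<open>4\<close>, whose addition is addition modulo 4 (likewise for
  16), and powers and products of groups are the componentwise structures on \<open>vec\<close> and
  \<open>prod\<close>.
\<close>

definition differences :: "'a::{finite,group_add} set \<Rightarrow> 'a multiset" where
  "differences D =
     image_mset (\<lambda>(d1, d2). d1 - d2) (mset_set {(d1, d2). d1 \<in> D \<and> d2 \<in> D \<and> d1 \<noteq> d2})"

lemma count_differences:
  "count (differences D) g =
     card {(d1, d2). d1 \<in> D \<and> d2 \<in> D \<and> d1 \<noteq> d2 \<and> d1 - d2 = g}"
  for D :: "'a::{finite,group_add} set"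
proof -
  have "{p \<in> {(d1, d2). d1 \<in> D \<and> d2 \<in> D \<and> d1 \<noteq> d2}. (\<lambda>(d1, d2). d1 - d2) p = g}
      = {(d1, d2). d1 \<in> D \<and> d2 \<in> D \<and> d1 \<noteq> d2 \<and> d1 - d2 = g}"
    by auto
  then show ?thesis
    unfolding differences_def count_image_mset'
    by (simp add: sum.If_cases Int_def conj_commute eq_commute)
qed

text \<open>\<open>D\<close> may contain 0; only non-identity differences are constrained.\<close>

definition is_PDS ::
  "nat \<Rightarrow> nat \<Rightarrow> nat \<Rightarrow> nat \<Rightarrow> 'a::{finite,group_add} set \<Rightarrow> bool" where
  "is_PDS v k l m D \<longleftrightarrow>
     CARD('a) = v \<and> card D = k \<and>
     (\<forall>g. g \<noteq> 0 \<and> g \<in> D \<longrightarrow> count (differences D) g = l) \<and>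
     (\<forall>g. g \<noteq> 0 \<and> g \<notin> D \<longrightarrow> count (differences D) g = m)"

definition neg_latin_square_params :: "nat \<Rightarrow> nat \<Rightarrow> nat \<Rightarrow> nat \<Rightarrow> bool" where
  "neg_latin_square_params v k l m \<longleftrightarrow>
     (\<exists>n r :: nat. n > 0 \<and> r > 0 \<and>
        v = n\<^sup>2 \<and> k = r * (n + 1) \<and>
        int l = - int n + (int r)\<^sup>2 + 3 * int r \<and> m = r\<^sup>2 + r)"

definition is_neg_latin_square_PDS ::
  "nat \<Rightarrow> nat \<Rightarrow> nat \<Rightarrow> nat \<Rightarrow> 'a::{finite,group_add} set \<Rightarrow> bool" where
  "is_neg_latin_square_PDS v k l m D \<longleftrightarrow> is_PDS v k l m D \<and> neg_latin_square_params v k l m"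

end

theory Submission
  imports Defs "HOL-Analysis.Cartesian_Space"
begin

text \<open>
  Give a Latin square type PDS with parameters \<open>n\<close>, \<open>r\<close> the signed parameters \<open>-n\<close>, \<open>-r\<close>; then both types
  share the formulas of the negative Latin square type. If three such sets with signed parameters \<open>n\<close> and
  \<open>r\<^sub>1\<close>, \<open>r\<^sub>2\<close>, \<open>r\<^sub>3\<close> partition the non-identity elements, every nontrivial character takes the value
  \<open>r\<^sub>i - n\<close> on exactly one of them and \<open>r\<^sub>i\<close> on the other two. Take such partitions \<open>A\<^sub>1, A\<^sub>2, A\<^sub>3\<close> of
  \<open>\<int>\<^sub>4\<^sup>4\<close> with \<open>n = 16\<close>, \<open>r\<^sub>i = 5\<close> and \<open>B\<^sub>1, B\<^sub>2, B\<^sub>3\<close> of \<open>\<int>\<^sub>1\<^sub>6\<^sup>2\<close> with \<open>n = -16\<close>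
  and \<open>r\<^sub>i = -5, -6, -6\<close>. On \<open>B\<^sub>1\<close>, \<open>B\<^sub>2 \<union> {0}\<close>, \<open>B\<^sub>3 \<union> {0}\<close> a nontrivial character takes the value 11 once
  and -5 twice, so \<open>A\<^sub>1 \<times> B\<^sub>1 \<union> A\<^sub>2 \<times> (B\<^sub>2 \<union> {0}) \<union> A\<^sub>3 \<times> (B\<^sub>3 \<union> {0})\<close> has only the nontrivial character
  values 85 and -171. Written with correlations, this computation needs no characters.
\<close>

section \<open>Correlations\<close>

text \<open>For the indicator of a set, \<open>corr f f z\<close> counts the pairs in the set with
  difference \<open>z\<close>. In the group ring it is the coefficient at \<open>z\<close> of f
  times the conjugate of g.\<close>

definition corr :: "('a::{finite,ab_group_add} \<Rightarrow> int) \<Rightarrow> ('a \<Rightarrow> int) \<Rightarrow> 'a \<Rightarrow> int" where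
  "corr f g z = (\<Sum>y\<in>UNIV. f (z + y) * g y)"

lemma corr_add_left: "corr (\<lambda>x. f x + g x) h z = corr f h z + corr g h z"
  by (simp add: corr_def algebra_simps sum.distrib)

lemma corr_add_right: "corr f (\<lambda>x. g x + h x) z = corr f g z + corr f h z"
  by (simp add: corr_def algebra_simps sum.distrib)

lemma corr_diff_left: "corr (\<lambda>x. f x - g x) h z = corr f h z - corr g h z"
  by (simp add: corr_def algebra_simps sum_subtractf)

lemma corr_diff_right: "corr f (\<lambda>x. g x - h x) z = corr f g z - corr f h z"
  by (simp add: corr_def algebra_simps sum_subtractf)

lemma sum_shift: "(\<Sum>y\<in>UNIV. f (z + y)) = (\<Sum>y\<in>UNIV. f y)"
  for f :: "'a::{finite,ab_group_add} \<Rightarrow> int"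
  by (rule sum.reindex_bij_witness[of _ "\<lambda>y. y - z" "\<lambda>y. z + y"]) auto

lemma corr_uminus: "corr f g (- z) = corr g f z"
  unfolding corr_def
  by (rule sum.reindex_bij_witness[of _ "\<lambda>y. z + y" "\<lambda>y. - z + y"]) (auto simp: mult.commute)

text \<open>Substituting \<open>- y\<close> for \<open>y\<close> shows that the correlation of even
  functions is even; \<open>corr_uminus\<close> then swaps the factors.\<close>

lemma corr_commute:
  assumes "\<And>x. f (- x) = f x" "\<And>x. g (- x) = g x"
  shows "corr f g z = corr g f z"
proof -
  have "corr f g (- z) = corr f g z"
    unfolding corr_def
  proof (rule sum.reindex_bij_witness[of _ uminus uminus])
    show "f (z + - y) * g (- y) = f (- z + y) * g y" for y
      using assms(1)[of "z - y"] assms(2)[of y] by simp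
  qed auto
  then show ?thesis
    by (simp add: corr_uminus)
qed

lemma corr_one_left: "corr (\<lambda>x. 1) f z = sum f UNIV"
  by (simp add: corr_def)

lemma corr_one_right: "corr f (\<lambda>x. 1) z = sum f UNIV"
  by (simp add: corr_def sum_shift)

lemma corr_delta_right: "corr f (\<lambda>x. of_bool (x = 0)) z = f z"
proof -
  have "corr f (\<lambda>x. of_bool (x = 0)) z = (\<Sum>y\<in>UNIV. if y = 0 then f (z + y) else 0)"
    unfolding corr_def by (intro sum.cong) auto
  then show ?thesis
    by simp
qed

lemma corr_delta_left: "corr (\<lambda>x. of_bool (x = 0)) f z = f (- z)"
  using corr_uminus[of "\<lambda>x. of_bool (x = 0)" f "- z"] by (simp add: corr_delta_right)

lemma corr_times:
  "corr (\<lambda>p. f (fst p) * u (snd p)) (\<lambda>p. g (fst p) * v (snd p)) (x, y) = corr f g x * corr u v y"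
  unfolding corr_def UNIV_Times_UNIV[symmetric] sum.cartesian_product' sum_product
  by (intro sum.cong refl) (simp add: case_prod_unfold mult_ac)

section \<open>Partitions into three partial difference sets\<close>

datatype label = Z | A | B | C

lemma all_label: "(\<forall>l. P l) \<longleftrightarrow> P Z \<and> P A \<and> P B \<and> P C"
  by (metis label.exhaust)

lemma ex_label: "(\<exists>l. P l) \<longleftrightarrow> P Z \<or> P A \<or> P B \<or> P C"
  by (metis label.exhaust)

definition cls :: "('a \<Rightarrow> label) \<Rightarrow> label \<Rightarrow> 'a \<Rightarrow> int" where
  "cls c k x = of_bool (c x = k)"

text \<open>The sign of \<open>n\<close> selects the type, so one locale serves both factors. Only
  autocorrelations are assumed; \<open>nondegenerate\<close> says that the multiplicities inside and
  outside a class differ.\<close>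

locale three_class =
  fixes c :: "'a::{finite,ab_group_add} \<Rightarrow> label" and n :: int and r :: "label \<Rightarrow> int"
  assumes c_eq_Z: "c x = Z \<longleftrightarrow> x = 0"
    and card_group: "int CARD('a) = n\<^sup>2"
    and sum_r: "r A + r B + r C = n - 1"
    and corr_self: "k \<noteq> Z \<Longrightarrow> corr (cls c k) (cls c k) z =
      (if z = 0 then r k * (n + 1) else (r k)\<^sup>2 + r k + (if c z = k then 2 * r k - n else 0))"
    and nondegenerate: "k \<noteq> Z \<Longrightarrow> n \<noteq> 2 * r k"
begin

lemma c_0: "c 0 = Z"
  by (simp add: c_eq_Z)

text \<open>Being a difference is a symmetric property, so unequal multiplicities make each class symmetric.\<close>

lemma c_uminus: "c (- x) = c x"
proof (cases "x = 0")
  case False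
  have "corr (cls c (c x)) (cls c (c x)) (- x) = corr (cls c (c x)) (cls c (c x)) x"
    by (rule corr_uminus)
  moreover have "c x \<noteq> Z"
    using False by (simp add: c_eq_Z)
  ultimately show ?thesis
    using False nondegenerate[of "c x"] by (auto simp: corr_self split: if_splits)
qed simp

lemma cls_uminus: "cls c k (- x) = cls c k x"
  by (simp add: cls_def c_uminus)

lemma sum_cls: "sum (cls c k) UNIV = r k * (n + 1)" if "k \<noteq> Z"
proof -
  have "sum (cls c k) UNIV = corr (cls c k) (cls c k) 0"
    unfolding corr_def by (intro sum.cong) (auto simp: cls_def)
  then show ?thesis
    using that by (simp add: corr_self)
qed

text \<open>Polarization: classes \<open>i\<close> and \<open>j\<close> together form the complement
  of 0 and the third class, so the autocorrelation of their union is known.\<close>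

lemma corr_cross:
  assumes ij: "i \<noteq> Z" "j \<noteq> Z" "i \<noteq> j"
  shows "corr (cls c i) (cls c j) z =
    (if z = 0 then 0
     else r i * r j + (if c z = i then r j else 0) + (if c z = j then r i else 0))"
proof -
  let ?\<delta> = "\<lambda>x. of_bool (x = 0) :: int"
  have "\<exists>k. k \<noteq> Z \<and> k \<noteq> i \<and> k \<noteq> j \<and> (\<forall>l. l = Z \<or> l = i \<or> l = j \<or> l = k)"
    using ij by (cases i; cases j) (simp_all add: all_label ex_label)
  then obtain k where k: "k \<noteq> Z" "k \<noteq> i" "k \<noteq> j" and all: "\<And>l. l = Z \<or> l = i \<or> l = j \<or> l = k"
    by blast
  have rk: "r k = n - 1 - r i - r j"
    using sum_r ij k by (cases i; cases j; cases k) auto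
  have union: "(\<lambda>x. cls c i x + cls c j x) = (\<lambda>x. (1 - ?\<delta> x) - cls c k x)"
  proof
    show "cls c i x + cls c j x = (1 - ?\<delta> x) - cls c k x" for x
      using all[of "c x"] ij k c_eq_Z[of x] by (auto simp: cls_def)
  qed
  \<comment> \<open>Symmetry makes the two mixed terms of the expansion equal.\<close>
  have "corr (cls c j) (cls c i) z = corr (cls c i) (cls c j) z"
    by (intro corr_commute cls_uminus)
  then have "2 * corr (cls c i) (cls c j) z =
      corr (\<lambda>x. cls c i x + cls c j x) (\<lambda>x. cls c i x + cls c j x) z
      - corr (cls c i) (cls c i) z - corr (cls c j) (cls c j) z"
    by (simp add: corr_add_left corr_add_right)
  also have "corr (\<lambda>x. cls c i x + cls c j x) (\<lambda>x. cls c i x + cls c j x) z =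
      n\<^sup>2 - 2 + ?\<delta> z - 2 * (r k * (n + 1)) + 2 * cls c k z + corr (cls c k) (cls c k) z"
    unfolding union
    using k by (simp add: corr_diff_left corr_diff_right corr_one_left corr_one_right
        corr_delta_left corr_delta_right sum_cls cls_uminus card_group)
  finally have "2 * corr (cls c i) (cls c j) z =
      2 * (if z = 0 then 0
           else r i * r j + (if c z = i then r j else 0) + (if c z = j then r i else 0))"
    using all[of "c z"] ij k c_eq_Z[of z] rk
    by (auto simp: corr_self cls_def[of c k z] c_0 power2_eq_square algebra_simps)
  then show ?thesis
    by simp
qed

end

section \<open>The product construction\<close>

definition product_set :: "('a \<Rightarrow> label) \<Rightarrow> ('b \<Rightarrow> label) \<Rightarrow> ('a \<times> 'b) set" where
  "product_set a b =
     {(x, y). a x = A \<and> b y = A \<or> a x = B \<and> b y \<in> {B, Z} \<or> a x = C \<and> b y \<in> {C, Z}}"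

lemma corr_product_set:
  fixes a :: "'a::{finite,ab_group_add} \<Rightarrow> label" and b :: "'b::{finite,ab_group_add} \<Rightarrow> label"
  assumes "three_class a n (\<lambda>_. r)"
    and "three_class b (- n) (\<lambda>k. if k = A then - r else - r - 1)"
    and N: "N = n\<^sup>2" and R: "R = r * (n + 1)"
  defines "D \<equiv> \<lambda>p. of_bool (p \<in> product_set a b) :: int"
  shows "corr D D p =
    (if p = 0 then R * (N + 1) else R\<^sup>2 + R + (if p \<in> product_set a b then 2 * R - N else 0))"
proof -
  interpret a: three_class a n "\<lambda>_. r" by fact
  interpret b: three_class b "- n" "\<lambda>k. if k = A then - r else - r - 1" by fact
  \<comment> \<open>Equal parameters in \<open>sum_r\<close> leave \<open>r\<close> as the only free
    quantity.\<close>
  have n: "n = 3 * r + 1"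
    using a.sum_r by simp
  \<comment> \<open>\<open>S k\<close> is the indicator of the set paired with class
    \<open>k\<close> of \<open>a\<close>. Adjoining 0 offsets the parameters of \<open>B\<close> and
    \<open>C\<close>, which are one below that of \<open>A\<close>.\<close>
  define S where "S k y = (if k = A then cls b A y else cls b k y + of_bool (y = 0))" for k y
  have D: "D = (\<lambda>p. cls a A (fst p) * S A (snd p) + cls a B (fst p) * S B (snd p)
                 + cls a C (fst p) * S C (snd p))"
    by (auto simp: D_def product_set_def S_def cls_def fun_eq_iff b.c_eq_Z b.c_0)
  obtain x y where p: "p = (x, y)"
    by (cases p)
  have bb: "corr (S j) (S k) y = corr (cls b j) (cls b k) y
      + (if k = A then 0 else cls b j y) + (if j = A then 0 else cls b k y)
      + (if j = A \<or> k = A then 0 else of_bool (y = 0))" for j k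
    unfolding S_def
    by (auto simp: corr_add_left corr_add_right corr_delta_left corr_delta_right b.cls_uminus)
  have "corr D D p =
      (\<Sum>j\<leftarrow>[A, B, C]. \<Sum>k\<leftarrow>[A, B, C]. corr (cls a j) (cls a k) x * corr (S j) (S k) y)"
    unfolding D p by (simp add: corr_add_left corr_add_right corr_times)
  \<comment> \<open>All nine products depend only on the labels of \<open>x\<close> and
    \<open>y\<close>, so each pair of labels leaves a polynomial identity in
    \<open>r\<close>.\<close>
  also have "\<dots> = (if p = 0 then R * (N + 1)
      else R\<^sup>2 + R + (if p \<in> product_set a b then 2 * R - N else 0))"
    unfolding p bb R N n using a.c_eq_Z[of x] b.c_eq_Z[of y]
    by (cases "a x"; cases "b y")
      (simp_all add: a.corr_self a.corr_cross b.corr_self b.corr_cross cls_def product_set_def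
        zero_prod_def n power2_eq_square algebra_simps)
  finally show ?thesis .
qed

section \<open>From correlations to multiplicities of differences\<close>

lemma corr_indicator: "corr (\<lambda>x. of_bool (x \<in> D)) (\<lambda>x. of_bool (x \<in> D)) z = int (card {y \<in> D. z + y \<in> D})"
proof -
  have "corr (\<lambda>x. of_bool (x \<in> D)) (\<lambda>x. of_bool (x \<in> D)) z =
      (\<Sum>y\<in>UNIV. of_bool (y \<in> {y \<in> D. z + y \<in> D}))"
    unfolding corr_def by (intro sum.cong) auto
  then show ?thesis
    by (simp add: sum_of_bool_eq)
qed

text \<open>A pair with difference \<open>g\<close> is determined by its second entry, and
  \<open>g \<noteq> 0\<close> makes its entries distinct.\<close>

lemma count_differences_eq_card:
  fixes D :: "'a::{finite,ab_group_add} set"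
  assumes "g \<noteq> 0"
  shows "count (differences D) g = card {y \<in> D. g + y \<in> D}"
  unfolding count_differences
  by (rule bij_betw_same_card[of snd], rule bij_betwI[of _ _ _ "\<lambda>y. (g + y, y)"])
    (use assms in \<open>auto simp: algebra_simps\<close>)

section \<open>The cyclic factors\<close>

text \<open>The residue as a list index. The types \<open>4\<close> and \<open>16\<close> are both
  of the form \<open>'a bit0\<close>.\<close>

definition ix :: "'a::finite bit0 \<Rightarrow> nat" where
  "ix x = nat (Rep_bit0 x)"

lemma Rep_bit0_nonneg: "0 \<le> Rep_bit0 x" for x :: "'a::finite bit0"
  by (metis bit0.Rep_mod bit0.size0 pos_mod_sign)

lemma ix_less: "ix x < CARD('a bit0)" for x :: "'a::finite bit0"
  using Rep_bit0_nonneg[of x] bit0.Rep_less_n[of x] unfolding ix_def by linarith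

lemma ix_add: "ix (x + y) = (ix x + ix y) mod CARD('a bit0)" for x y :: "'a::finite bit0"
proof -
  have "Rep_bit0 (x + y) = (Rep_bit0 x + Rep_bit0 y) mod int CARD('a bit0)"
    by (simp only: bit0.add_def bit0.Rep_Abs_mod)
  then show ?thesis
    unfolding ix_def using Rep_bit0_nonneg[of x] Rep_bit0_nonneg[of y]
    by (simp add: nat_mod_distrib nat_add_distrib del: card_bit0)
qed

lemma ix_eq_0_iff: "ix x = 0 \<longleftrightarrow> x = 0" for x :: "'a::finite bit0"
  using Rep_bit0_nonneg[of x] bit0.Rep_0 bit0.Rep_inject_sym[of x 0] unfolding ix_def
  by (metis nat_0 nat_eq_iff2 order_antisym_conv of_nat_0)

lemma sum_ix: "(\<Sum>x\<in>(UNIV :: 'a::finite bit0 set). f (ix x)) = (\<Sum>i<CARD('a bit0). f i)"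
  for f :: "nat \<Rightarrow> int"
proof -
  have inj: "inj (ix :: 'a bit0 \<Rightarrow> nat)"
    by (rule injI) (metis Rep_bit0_nonneg bit0.Rep_inject_sym eq_nat_nat_iff ix_def)
  have "ix ` (UNIV :: 'a bit0 set) = {..<CARD('a bit0)}"
    by (rule card_subset_eq) (use ix_less in \<open>auto simp: card_image[OF inj] simp del: card_bit0\<close>)
  then show ?thesis
    using sum.reindex[OF inj, of f] by (simp add: o_def)
qed

lemma sum_vec_2: "(\<Sum>x\<in>(UNIV :: ('a ^ 2) set). f (x $ 1) (x $ 2)) = (\<Sum>a\<in>UNIV. \<Sum>b\<in>UNIV. f a b)"
  for f :: "'a::finite \<Rightarrow> 'a \<Rightarrow> int"
  unfolding sum.cartesian_product UNIV_Times_UNIV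
  by (rule sum.reindex_bij_witness[of _ "\<lambda>(a, b). \<chi> i. if i = 1 then a else b" "\<lambda>x. (x $ 1, x $ 2)"])
    (auto simp: vec_eq_iff forall_2)

text \<open>In the index type \<open>4\<close> the numeral 4 equals 0, so 1, 2, 3, 4 exhaust the
  coordinates.\<close>

lemma sum_vec_4:
  "(\<Sum>x\<in>(UNIV :: ('a ^ 4) set). f (x $ 1) (x $ 2) (x $ 3) (x $ 4)) =
    (\<Sum>a\<in>UNIV. \<Sum>b\<in>UNIV. \<Sum>c\<in>UNIV. \<Sum>d\<in>UNIV. f a b c d)"
  for f :: "'a::finite \<Rightarrow> 'a \<Rightarrow> 'a \<Rightarrow> 'a \<Rightarrow> int"
  unfolding sum.cartesian_product UNIV_Times_UNIV
  by (rule sum.reindex_bij_witness[of _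
        "\<lambda>(a, b, c, d). \<chi> i. if i = 1 then a else if i = 2 then b else if i = 3 then c else d"
        "\<lambda>x. (x $ 1, x $ 2, x $ 3, x $ 4)"])
    (auto simp: vec_eq_iff forall_4)

section \<open>Correlations of nested lists\<close>

text \<open>The first list is rotated by \<open>g\<close>, and \<open>h\<close> takes the place of
  multiplication. Taking for \<open>h\<close> a correlation of rows gives correlations in several
  coordinates, in a form that can be evaluated.\<close>

definition cyclic_corr :: "('b \<Rightarrow> 'b \<Rightarrow> nat) \<Rightarrow> nat \<Rightarrow> 'b list \<Rightarrow> 'b list \<Rightarrow> nat" where
  "cyclic_corr h g xs ys = sum_list (map2 h (drop g xs @ take g xs) ys)"

lemma cyclic_corr_eq_sum:
  assumes "length xs = n" "length ys = n" "g < n"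
  shows "cyclic_corr h g xs ys = (\<Sum>i<n. h (xs ! ((g + i) mod n)) (ys ! i))"
proof -
  have "drop g xs @ take g xs = rotate g xs"
    using assms by (simp add: rotate_drop_take)
  then show ?thesis
    using assms
    by (simp add: cyclic_corr_def sum_list_sum_nth nth_rotate atLeast0LessThan)
qed

definition both :: "label \<Rightarrow> label \<Rightarrow> label \<Rightarrow> nat" where
  "both k u v = (if u = k then if v = k then 1 else 0 else 0)"

lemma cls_mult_cls: "of_bool (u = k) * of_bool (v = k) = int (both k u v)"
  by (simp add: both_def)

definition expected_corr :: "label \<Rightarrow> label \<Rightarrow> nat \<Rightarrow> nat \<Rightarrow> nat \<Rightarrow> nat" where
  "expected_corr k v card_k l m = (if v = Z then card_k else if v = k then l else m)"

text \<open>
  Both tables come from a computer search over invariant labellings. In the first, the entry at \<open>i, j, l, m\<close>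
  belongs to \<open>i + j t + l t\<^sup>2 + m t\<^sup>3\<close> in the Galois ring \<open>\<int>\<^sub>4[t] / (t\<^sup>4 + 2 t\<^sup>2 + 3 t + 1)\<close>, where \<open>t\<close> has
  order 15: the classes are invariant under \<open>-1\<close> and \<open>t\<^sup>3\<close>, and \<open>t\<close> permutes them cyclically. The classes of
  the second are invariant under odd scalars and under the automorphism \<open>(x, y) \<mapsto> (-y, x - y)\<close> of
  order 3.
\<close>

definition table_4 :: "label list list list list" where
  "table_4 =
  [[[[Z, A, A, A], [C, A, C, A], [C, A, A, A], [C, A, C, A]],
    [[B, C, A, B], [C, C, A, C], [B, A, A, B], [C, B, C, A]],
    [[B, A, A, A], [C, C, A, B], [C, C, C, C], [C, B, A, C]],
    [[B, B, A, C], [C, A, C, B], [B, B, A, A], [C, C, A, C]]],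
   [[[A, B, A, B], [B, B, C, C], [C, A, A, C], [A, C, C, B]],
    [[B, B, C, C], [B, C, B, B], [C, A, A, B], [B, A, A, A]],
    [[A, C, B, C], [C, B, B, A], [C, A, B, C], [A, B, C, A]],
    [[B, C, A, A], [A, C, B, A], [B, B, B, B], [C, A, C, B]]],
   [[[A, B, C, B], [C, A, A, C], [C, C, B, C], [C, C, A, A]],
    [[B, A, B, A], [B, A, C, C], [C, A, C, C], [A, B, B, C]],
    [[B, A, B, A], [B, B, B, A], [B, B, A, B], [B, A, B, B]],
    [[B, A, B, A], [A, C, B, B], [C, C, C, A], [B, C, C, A]]],
   [[[A, B, A, B], [A, B, C, C], [C, C, A, A], [B, C, C, B]],
    [[B, A, A, C], [C, B, C, A], [B, B, B, B], [A, A, B, C]],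
    [[A, C, B, C], [A, A, C, B], [C, C, B, A], [C, A, B, B]],
    [[B, C, C, B], [B, A, A, A], [C, B, A, A], [B, B, B, C]]]]"

definition table_16 :: "label list list" where
  "table_16 =
  [[Z, C, B, C, C, C, B, C, A, C, B, C, C, C, B, C],
   [C, C, C, A, C, C, A, B, B, B, B, B, A, A, B, C],
   [B, C, B, B, C, B, A, A, A, C, A, B, A, B, C, A],
   [C, B, A, C, A, B, C, A, B, A, B, B, C, C, B, C],
   [C, A, C, C, C, A, A, C, B, A, C, C, B, A, A, C],
   [C, A, B, B, C, C, B, B, B, C, C, C, A, B, A, A],
   [B, B, A, C, A, A, B, B, A, B, C, C, C, A, A, B],
   [C, B, B, C, A, A, B, C, B, C, A, A, C, B, C, B],
   [A, B, A, B, B, B, A, B, A, B, A, B, B, B, A, B],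
   [C, B, C, B, C, A, A, C, B, C, B, A, A, C, B, B],
   [B, B, A, A, C, C, C, B, A, B, B, A, A, C, A, B],
   [C, A, A, B, A, C, C, C, B, B, B, C, C, B, B, A],
   [C, C, A, A, B, C, C, A, B, C, A, A, C, C, C, A],
   [C, C, B, C, C, B, B, A, B, A, C, B, A, C, A, B],
   [B, A, C, B, A, B, A, C, A, A, A, B, C, B, B, C],
   [C, C, B, A, A, B, B, B, B, B, A, C, C, A, C, C]]"

definition class_4 :: "4 ^ 4 \<Rightarrow> label" where
  "class_4 x = table_4 ! ix (x $ 1) ! ix (x $ 2) ! ix (x $ 3) ! ix (x $ 4)"

definition class_16 :: "16 ^ 2 \<Rightarrow> label" where
  "class_16 x = table_16 ! ix (x $ 1) ! ix (x $ 2)"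

lemma length_table_4:
  "length table_4 = 4"
  "i < 4 \<Longrightarrow> length (table_4 ! i) = 4"
  "i < 4 \<Longrightarrow> j < 4 \<Longrightarrow> length (table_4 ! i ! j) = 4"
  "i < 4 \<Longrightarrow> j < 4 \<Longrightarrow> k < 4 \<Longrightarrow> length (table_4 ! i ! j ! k) = 4"
proof -
  have "length table_4 = 4 \<and> list_all (\<lambda>t. length t = 4 \<and> list_all (\<lambda>u. length u = 4 \<and>
      list_all (\<lambda>v. length v = 4) u) t) table_4"
    by code_simp
  then show "length table_4 = 4"
    "i < 4 \<Longrightarrow> length (table_4 ! i) = 4"
    "i < 4 \<Longrightarrow> j < 4 \<Longrightarrow> length (table_4 ! i ! j) = 4"
    "i < 4 \<Longrightarrow> j < 4 \<Longrightarrow> k < 4 \<Longrightarrow> length (table_4 ! i ! j ! k) = 4"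
    by (simp_all add: list_all_length)
qed

lemma length_table_16: "length table_16 = 16" "i < 16 \<Longrightarrow> length (table_16 ! i) = 16"
proof -
  have "length table_16 = 16 \<and> list_all (\<lambda>t. length t = 16) table_16"
    by code_simp
  then show "length table_16 = 16" "i < 16 \<Longrightarrow> length (table_16 ! i) = 16"
    by (simp_all add: list_all_length)
qed

lemma ix_less_4: "ix (x::4) < 4" and ix_less_16: "ix (y::16) < 16"
  using ix_less[of x] ix_less[of y] by simp_all

text \<open>The group sum becomes an iterated sum over indices, which is folded into cyclic
  correlations from the last coordinate outwards.\<close>

lemma corr_class_16:
  "corr (cls class_16 k) (cls class_16 k) z =
    int (cyclic_corr (cyclic_corr (both k) (ix (z $ 2))) (ix (z $ 1)) table_16 table_16)"
proof -
  define p q where "p = ix (z $ 1)" and "q = ix (z $ 2)"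
  have pq: "p < 16" "q < 16"
    by (simp_all add: p_def q_def ix_less_16)
  have "corr (cls class_16 k) (cls class_16 k) z =
      (\<Sum>x\<in>(UNIV :: (16 ^ 2) set). int (both k (table_16 ! ((p + ix (x $ 1)) mod 16) ! ((q + ix (x $ 2)) mod 16))
        (table_16 ! ix (x $ 1) ! ix (x $ 2))))"
    by (simp add: corr_def cls_def class_16_def cls_mult_cls ix_add p_def q_def)
  also have "\<dots> = (\<Sum>i<16. \<Sum>j<16. int (both k (table_16 ! ((p + i) mod 16) ! ((q + j) mod 16))
        (table_16 ! i ! j)))"
    by (subst sum_vec_2, subst sum_ix, subst sum_ix) simp
  also have "\<dots> = int (\<Sum>i<16. cyclic_corr (both k) q (table_16 ! ((p + i) mod 16)) (table_16 ! i))"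
    by (simp add: cyclic_corr_eq_sum[where n = 16] length_table_16 pq)
  also have "\<dots> = int (cyclic_corr (cyclic_corr (both k) q) p table_16 table_16)"
    by (simp add: cyclic_corr_eq_sum[where n = 16] length_table_16 pq)
  finally show ?thesis
    by (simp add: p_def q_def)
qed

lemma corr_class_4:
  "corr (cls class_4 k) (cls class_4 k) z =
    int (cyclic_corr (cyclic_corr (cyclic_corr (cyclic_corr (both k) (ix (z $ 4))) (ix (z $ 3)))
      (ix (z $ 2))) (ix (z $ 1)) table_4 table_4)"
proof -
  define p q s t where "p = ix (z $ 1)" and "q = ix (z $ 2)" and "s = ix (z $ 3)" and "t = ix (z $ 4)"
  have pqst: "p < 4" "q < 4" "s < 4" "t < 4"
    by (simp_all add: p_def q_def s_def t_def ix_less_4)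
  have "corr (cls class_4 k) (cls class_4 k) z =
      (\<Sum>x\<in>(UNIV :: (4 ^ 4) set). int (both k
        (table_4 ! ((p + ix (x $ 1)) mod 4) ! ((q + ix (x $ 2)) mod 4)
          ! ((s + ix (x $ 3)) mod 4) ! ((t + ix (x $ 4)) mod 4))
        (table_4 ! ix (x $ 1) ! ix (x $ 2) ! ix (x $ 3) ! ix (x $ 4))))"
    by (simp add: corr_def cls_def class_4_def cls_mult_cls ix_add p_def q_def s_def t_def)
  also have "\<dots> = (\<Sum>i<4. \<Sum>j<4. \<Sum>l<4. \<Sum>m<4. int (both k
        (table_4 ! ((p + i) mod 4) ! ((q + j) mod 4) ! ((s + l) mod 4) ! ((t + m) mod 4))
        (table_4 ! i ! j ! l ! m)))"
    by (subst sum_vec_4, subst sum_ix, subst sum_ix, subst sum_ix, subst sum_ix) simp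
  also have "\<dots> = int (\<Sum>i<4. \<Sum>j<4. \<Sum>l<4. cyclic_corr (both k) t
        (table_4 ! ((p + i) mod 4) ! ((q + j) mod 4) ! ((s + l) mod 4)) (table_4 ! i ! j ! l))"
    by (simp add: cyclic_corr_eq_sum[where n = 4] length_table_4 pqst)
  also have "\<dots> = int (\<Sum>i<4. \<Sum>j<4. cyclic_corr (cyclic_corr (both k) t) s
        (table_4 ! ((p + i) mod 4) ! ((q + j) mod 4)) (table_4 ! i ! j))"
    by (simp add: cyclic_corr_eq_sum[where n = 4] length_table_4 pqst)
  also have "\<dots> = int (\<Sum>i<4. cyclic_corr (cyclic_corr (cyclic_corr (both k) t) s) q
        (table_4 ! ((p + i) mod 4)) (table_4 ! i))"
    by (simp add: cyclic_corr_eq_sum[where n = 4] length_table_4 pqst)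
  also have "\<dots> = int (cyclic_corr (cyclic_corr (cyclic_corr (cyclic_corr (both k) t) s) q) p
        table_4 table_4)"
    by (simp add: cyclic_corr_eq_sum[where n = 4] length_table_4 pqst)
  finally show ?thesis
    by (simp add: p_def q_def s_def t_def)
qed

section \<open>Verification of the tables by evaluation\<close>

lemma class_4_eq_Z_iff: "class_4 x = Z \<longleftrightarrow> x = 0"
proof -
  have "list_all (\<lambda>i. list_all (\<lambda>j. list_all (\<lambda>l. list_all (\<lambda>m.
      (table_4 ! i ! j ! l ! m = Z) = (i = 0 \<and> j = 0 \<and> l = 0 \<and> m = 0))
      [0..<4]) [0..<4]) [0..<4]) [0..<4]"
    by code_simp
  then show ?thesis
    using ix_less_4 by (simp add: class_4_def list_all_iff ix_eq_0_iff vec_eq_iff forall_4)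
qed

lemma class_16_eq_Z_iff: "class_16 x = Z \<longleftrightarrow> x = 0"
proof -
  have "list_all (\<lambda>i. list_all (\<lambda>j. (table_16 ! i ! j = Z) = (i = 0 \<and> j = 0)) [0..<16]) [0..<16]"
    by code_simp
  then show ?thesis
    using ix_less_16 by (simp add: class_16_def list_all_iff ix_eq_0_iff vec_eq_iff forall_2)
qed

text \<open>With \<open>n = 16\<close>, \<open>r = 5\<close>: 85 = 5 * 17, 30 = 25 + 5 and 24 = 30 +
  10 - 16.\<close>

lemma table_4_corr:
  "list_all (\<lambda>k. list_all (\<lambda>i. list_all (\<lambda>j. list_all (\<lambda>l. list_all (\<lambda>m.
    cyclic_corr (cyclic_corr (cyclic_corr (cyclic_corr (both k) m) l) j) i table_4 table_4
      = expected_corr k (table_4 ! i ! j ! l ! m) 85 24 30)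
    [0..<4]) [0..<4]) [0..<4]) [0..<4]) [A, B, C]"
  by code_simp

text \<open>With \<open>n = -16\<close>, the parameter -5 gives 75, 26, 20 and the parameter -6
  gives 90, 34, 30.\<close>

lemma table_16_corr:
  "list_all (\<lambda>(k, card_k, l, m). list_all (\<lambda>i. list_all (\<lambda>j.
    cyclic_corr (cyclic_corr (both k) j) i table_16 table_16
      = expected_corr k (table_16 ! i ! j) card_k l m)
    [0..<16]) [0..<16]) [(A, 75, 26, 20), (B, 90, 34, 30), (C, 90, 34, 30)]"
  by code_simp

lemma three_class_4: "three_class class_4 16 (\<lambda>_. 5)"
proof
  fix k z
  assume "k \<noteq> Z"
  then consider "k = A" | "k = B" | "k = C"
    by (cases k) auto
  then have "corr (cls class_4 k) (cls class_4 k) z = int (expected_corr k (class_4 z) 85 24 30)"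
    using table_4_corr ix_less_4
    by cases (simp_all add: corr_class_4 class_4_def list_all_iff)
  then show "corr (cls class_4 k) (cls class_4 k) z =
      (if z = 0 then 5 * (16 + 1) else 5\<^sup>2 + 5 + (if class_4 z = k then 2 * 5 - 16 else 0))"
    using \<open>k \<noteq> Z\<close> class_4_eq_Z_iff[of z] by (simp add: expected_corr_def)
qed (simp_all add: class_4_eq_Z_iff)

text \<open>The unevaluated \<open>- 5 - 1\<close> matches the form \<open>- r - 1\<close> in
  \<open>corr_product_set\<close>.\<close>

lemma three_class_16: "three_class class_16 (- 16) (\<lambda>k. if k = A then - 5 else - 5 - 1)"
proof
  fix k z
  assume "k \<noteq> Z"
  then consider "k = A" | "k = B" | "k = C"
    by (cases k) auto
  then show "corr (cls class_16 k) (cls class_16 k) z =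
      (if z = 0 then (if k = A then - 5 else - 5 - 1) * (- 16 + 1)
       else (if k = A then - 5 else - 5 - 1)\<^sup>2 + (if k = A then - 5 else - 5 - 1)
         + (if class_16 z = k then 2 * (if k = A then - 5 else - 5 - 1) - - 16 else 0))"
    using table_16_corr ix_less_16 class_16_eq_Z_iff[of z]
    by cases (simp_all add: corr_class_16 list_all_iff expected_corr_def
        flip: class_16_def)
qed (simp_all add: class_16_eq_Z_iff)

theorem theorem5p1:
  "\<exists>D :: ((4 ^ 4) \<times> (16 ^ 2)) set. is_neg_latin_square_PDS 65536 21845 7224 7310 D"
proof
  let ?D = "product_set class_4 class_16"
  have *: "int (card {y \<in> ?D. g + y \<in> ?D}) = (if g = 0 then 21845 else if g \<in> ?D then 7224 else 7310)" for g
    \<comment> \<open>Here \<open>N\<close> = 256 and \<open>R\<close> = 5 * 17 = 85, so the values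
      are 85 * 257, 85 * 86 + 170 - 256 and 85 * 86.\<close>
    using corr_product_set[OF three_class_4 three_class_16 refl refl, of g]
    by (simp add: corr_indicator)
  have "card ?D = 21845"
    using *[of 0] by simp
  moreover have "count (differences ?D) g = (if g \<in> ?D then 7224 else 7310)" if "g \<noteq> 0" for g
    using *[of g] that by (simp add: count_differences_eq_card split: if_splits)
  ultimately have "is_PDS 65536 21845 7224 7310 ?D"
    by (simp add: is_PDS_def)
  moreover have "neg_latin_square_params 65536 21845 7224 7310"
    unfolding neg_latin_square_params_def by (rule exI[of _ 256], rule exI[of _ 85]) simp
  ultimately show "is_neg_latin_square_PDS 65536 21845 7224 7310 ?D"
    by (simp add: is_neg_latin_square_PDS_def)
qed

end
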